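(* If $S$ is an exact semiring then, for every positive integer $n$, the matrix semiring $M_n(S)$ is exact.
   Context: A semiring is a set $S$ with a commutative associative addition and an associative (not necessarily commutative) multiplication distributing over addition from both sides, such that for every non-empty finite subset $L\subseteq S$ there are local identities $0_L,1_L\in S$ with $a+0_Lb=1_La=a$ and $a+b0_L=a1_L=a$ for all $a,b\in L$. (No global zero or identity is required.) $S^{m\times n}$ is the set of $m\times n$ matrices over $S$, with the usual matrix addition and multiplication; $M_n(S)=S^{n\times n}$, which is itself a semiring. For $A\in S^{m\times n}$, $\operatorname{Row}(A)=\{uA: u\in S^{1\times m}\}\subseteq S^{1\times n}$ and $\operatorname{Col}(A)=\{Av: v\in S^{n\times 1}\}\subseteq S^{m\times 1}$. A semiring $S$ is exact if for all positive integers $m,n$ and all $A\in S^{m\times n}$: (E1) if $x\in S^{1\times n}\setminus\operatorname{Row}(A)$ then there are $v,v'\in S^{n\times 1}$ with $Av=Av'$ but $xv\neq xv'$; and (E2) if $y\in S^{m\times 1}\setminus\operatorname{Col}(A)$ then there are $u,u'\in S^{1\times m}$ with $uA=u'A$ but $uy\neq u'y$. *)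

theory Defs
  imports "Jordan_Normal_Form.Matrix"
begin

text \<open>
  Semirings here have no global zero or identity, so neither the type classes nor the
  \<open>ring\<close> record of HOL-Algebra apply. They are carrier-based, since matrix semirings of
  every size have to be instances of the same notion.
\<close>

record 'a srng = "'a partial_object" +
  sadd :: "'a \<Rightarrow> 'a \<Rightarrow> 'a" (infixl "\<boxplus>\<index>" 65)
  smul :: "'a \<Rightarrow> 'a \<Rightarrow> 'a" (infixl "\<boxtimes>\<index>" 70)

text \<open>In \<open>local_identities\<close>, \<open>z\<close> and \<open>e\<close> are the elements \<open>0\<^sub>L\<close> and \<open>1\<^sub>L\<close>.\<close>

locale local_semiring =
  fixes S :: "('a, 'm) srng_scheme" (structure)
  assumes add_closed: "\<lbrakk>a \<in> carrier S; b \<in> carrier S\<rbrakk> \<Longrightarrow> a \<boxplus> b \<in> carrier S"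
    and mul_closed: "\<lbrakk>a \<in> carrier S; b \<in> carrier S\<rbrakk> \<Longrightarrow> a \<boxtimes> b \<in> carrier S"
    and add_assoc: "\<lbrakk>a \<in> carrier S; b \<in> carrier S; c \<in> carrier S\<rbrakk>
          \<Longrightarrow> (a \<boxplus> b) \<boxplus> c = a \<boxplus> (b \<boxplus> c)"
    and add_commute: "\<lbrakk>a \<in> carrier S; b \<in> carrier S\<rbrakk> \<Longrightarrow> a \<boxplus> b = b \<boxplus> a"
    and mul_assoc: "\<lbrakk>a \<in> carrier S; b \<in> carrier S; c \<in> carrier S\<rbrakk>
          \<Longrightarrow> (a \<boxtimes> b) \<boxtimes> c = a \<boxtimes> (b \<boxtimes> c)"
    and distrib_left: "\<lbrakk>a \<in> carrier S; b \<in> carrier S; c \<in> carrier S\<rbrakk>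
          \<Longrightarrow> a \<boxtimes> (b \<boxplus> c) = a \<boxtimes> b \<boxplus> a \<boxtimes> c"
    and distrib_right: "\<lbrakk>a \<in> carrier S; b \<in> carrier S; c \<in> carrier S\<rbrakk>
          \<Longrightarrow> (a \<boxplus> b) \<boxtimes> c = a \<boxtimes> c \<boxplus> b \<boxtimes> c"
    and local_identities: "\<lbrakk>finite L; L \<noteq> {}; L \<subseteq> carrier S\<rbrakk>
          \<Longrightarrow> \<exists>z \<in> carrier S. \<exists>e \<in> carrier S. \<forall>a \<in> L. \<forall>b \<in> L.
                a \<boxplus> z \<boxtimes> b = a \<and> e \<boxtimes> a = a \<and> a \<boxplus> b \<boxtimes> z = a \<and> a \<boxtimes> e = a"

text \<open>Without a zero only non-empty sums make sense: \<open>ssum S f k\<close> is \<open>f 0 + \<dots> + f k\<close>,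
  with \<open>k + 1\<close> summands.\<close>

primrec ssum :: "('a, 'm) srng_scheme \<Rightarrow> (nat \<Rightarrow> 'a) \<Rightarrow> nat \<Rightarrow> 'a" where
  "ssum S f 0 = f 0"
| "ssum S f (Suc k) = ssum S f k \<boxplus>\<^bsub>S\<^esub> f (Suc k)"

definition mats :: "('a, 'm) srng_scheme \<Rightarrow> nat \<Rightarrow> nat \<Rightarrow> 'a mat set" where
  "mats S m n = {A \<in> carrier_mat m n. elements_mat A \<subseteq> carrier S}"

definition mat_add :: "('a, 'm) srng_scheme \<Rightarrow> 'a mat \<Rightarrow> 'a mat \<Rightarrow> 'a mat" where
  "mat_add S A B = mat (dim_row A) (dim_col A) (\<lambda>(i, j). A $$ (i, j) \<boxplus>\<^bsub>S\<^esub> B $$ (i, j))"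

text \<open>The product is meaningful only if the inner dimension \<open>dim_col A = dim_row B\<close> is positive.\<close>

definition mat_mul :: "('a, 'm) srng_scheme \<Rightarrow> 'a mat \<Rightarrow> 'a mat \<Rightarrow> 'a mat" where
  "mat_mul S A B = mat (dim_row A) (dim_col B)
     (\<lambda>(i, j). ssum S (\<lambda>k. A $$ (i, k) \<boxtimes>\<^bsub>S\<^esub> B $$ (k, j)) (dim_col A - 1))"

definition matrix_semiring :: "('a, 'm) srng_scheme \<Rightarrow> nat \<Rightarrow> 'a mat srng" where
  "matrix_semiring S n = \<lparr>carrier = mats S n n, sadd = mat_add S, smul = mat_mul S\<rparr>"

definition Row :: "('a, 'm) srng_scheme \<Rightarrow> 'a mat \<Rightarrow> 'a mat set" where
  "Row S A = {mat_mul S u A | u. u \<in> mats S 1 (dim_row A)}"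

definition Col :: "('a, 'm) srng_scheme \<Rightarrow> 'a mat \<Rightarrow> 'a mat set" where
  "Col S A = {mat_mul S A v | v. v \<in> mats S (dim_col A) 1}"

locale exact_semiring = local_semiring S
  for S :: "('a, 'm) srng_scheme" (structure) +
  assumes E1: "\<lbrakk>0 < m; 0 < n; A \<in> mats S m n; x \<in> mats S 1 n - Row S A\<rbrakk>
        \<Longrightarrow> \<exists>v \<in> mats S n 1. \<exists>v' \<in> mats S n 1.
              mat_mul S A v = mat_mul S A v' \<and> mat_mul S x v \<noteq> mat_mul S x v'"
    and E2: "\<lbrakk>0 < m; 0 < n; A \<in> mats S m n; y \<in> mats S m 1 - Col S A\<rbrakk>
        \<Longrightarrow> \<exists>u \<in> mats S 1 m. \<exists>u' \<in> mats S 1 m.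
              mat_mul S u A = mat_mul S u' A \<and> mat_mul S u y \<noteq> mat_mul S u' y"

end

theory Submission
  imports Defs
begin

text \<open>
  A matrix over \<open>M\<^sub>n(S)\<close> is the same thing as a block matrix over \<open>S\<close>. Erasing the block
  boundaries (\<open>flatten\<close>) is injective and multiplicative (\<open>flatten_mat_mul\<close>), which reduces
  exactness of \<open>M\<^sub>n(S)\<close> to exactness of \<open>S\<close> for matrices whose dimensions are multiples of \<open>n\<close>.

  For (E1), let \<open>A\<close> be \<open>m \<times> p\<close> and \<open>x\<close> be \<open>1 \<times> p\<close> over \<open>M\<^sub>n(S)\<close>. The flattened \<open>x\<close> has \<open>n\<close> rows.
  If each of them were in the row space of the flattened \<open>A\<close>, stacking the coefficient vectors
  and restoring the blocks would show that \<open>x\<close> is in the row space of \<open>A\<close>. So some row is not,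
  and (E1) in \<open>S\<close> gives columns \<open>v, v'\<close> that have equal products with the flattened \<open>A\<close> but
  different products with this row. Repeating \<open>v\<close> and \<open>v'\<close> \<open>n\<close> times yields two matrices with
  \<open>n\<close> columns, that is, two columns over \<open>M\<^sub>n(S)\<close>, which have equal products with \<open>A\<close> but
  different products with \<open>x\<close>. Repeating the column, instead of padding it, avoids the need for
  a zero. (E2) is dual.

  That \<open>M\<^sub>n(S)\<close> is a semiring with local identities is a computation with finite sums. Given
  finitely many matrices, with local identities \<open>z\<close> and \<open>e\<close> for all their entries, the constant
  matrix \<open>z\<close> is a local zero, and the matrix with \<open>e\<close> on the diagonal and \<open>z\<close> elsewhere is a
  local one.
\<close>

section \<open>Non-empty sums\<close>

lemma ssum_cong:
  "(\<And>i. i \<le> k \<Longrightarrow> f i = g i) \<Longrightarrow> ssum S f k = ssum S g k"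
  by (induction k) auto

context local_semiring
begin

lemma ssum_closed:
  "(\<And>i. i \<le> k \<Longrightarrow> f i \<in> carrier S) \<Longrightarrow> ssum S f k \<in> carrier S"
  by (induction k) (auto intro: add_closed)

lemma add_left_commute:
  "\<lbrakk>a \<in> carrier S; b \<in> carrier S; c \<in> carrier S\<rbrakk> \<Longrightarrow> a \<boxplus> (b \<boxplus> c) = b \<boxplus> (a \<boxplus> c)"
  by (metis add_assoc add_commute)

lemma ssum_add:
  assumes "\<And>i. i \<le> k \<Longrightarrow> f i \<in> carrier S" and "\<And>i. i \<le> k \<Longrightarrow> g i \<in> carrier S"
  shows "ssum S (\<lambda>i. f i \<boxplus> g i) k = ssum S f k \<boxplus> ssum S g k"
  using assms
proof (induction k)
  case (Suc k)
  have "ssum S f k \<in> carrier S" "ssum S g k \<in> carrier S"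
       "f (Suc k) \<in> carrier S" "g (Suc k) \<in> carrier S"
    using Suc.prems by (auto intro: ssum_closed)
  then show ?case
    using Suc by (simp add: add_assoc add_left_commute add_closed)
qed simp

lemma ssum_mul_left:
  assumes "a \<in> carrier S" and "\<And>i. i \<le> k \<Longrightarrow> f i \<in> carrier S"
  shows "a \<boxtimes> ssum S f k = ssum S (\<lambda>i. a \<boxtimes> f i) k"
  using assms by (induction k) (auto simp: distrib_left ssum_closed)

lemma ssum_mul_right:
  assumes "a \<in> carrier S" and "\<And>i. i \<le> k \<Longrightarrow> f i \<in> carrier S"
  shows "ssum S f k \<boxtimes> a = ssum S (\<lambda>i. f i \<boxtimes> a) k"
  using assms by (induction k) (auto simp: distrib_right ssum_closed)

lemma ssum_swap:
  assumes "\<And>i j. \<lbrakk>i \<le> k; j \<le> l\<rbrakk> \<Longrightarrow> f i j \<in> carrier S"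
  shows "ssum S (\<lambda>i. ssum S (\<lambda>j. f i j) l) k = ssum S (\<lambda>j. ssum S (\<lambda>i. f i j) k) l"
  using assms
proof (induction k)
  case (Suc k)
  then show ?case
    by (simp add: ssum_add ssum_closed)
qed simp

lemma ssum_append:
  assumes "\<And>i. i \<le> a + Suc b \<Longrightarrow> f i \<in> carrier S"
  shows "ssum S f (a + Suc b) = ssum S f a \<boxplus> ssum S (\<lambda>i. f (Suc a + i)) b"
  using assms
proof (induction b)
  case (Suc b)
  have "ssum S f a \<in> carrier S" "ssum S (\<lambda>i. f (Suc a + i)) b \<in> carrier S"
    using Suc.prems by (auto intro!: ssum_closed)
  then show ?case
    using Suc by (simp add: add_assoc)
qed simp

lemma ssum_blocks:
  assumes "0 < n" and "0 < p" and "\<And>i. i < p * n \<Longrightarrow> f i \<in> carrier S"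
  shows "ssum S f (p * n - 1) = ssum S (\<lambda>K. ssum S (\<lambda>k. f (K * n + k)) (n - 1)) (p - 1)"
proof -
  obtain q b where p: "p = Suc q" and n: "n = Suc b"
    using assms by (metis gr0_conv_Suc)
  have split: "ssum S f (q * n + b) = ssum S (\<lambda>K. ssum S (\<lambda>k. f (K * n + k)) b) q"
    if "\<And>i. i < Suc q * n \<Longrightarrow> f i \<in> carrier S" for q
    using that
  proof (induction q)
    case (Suc q)
    have "ssum S f (Suc q * n + b) = ssum S f ((q * n + b) + Suc b)"
      by (simp add: n ac_simps)
    also have "\<dots> = ssum S f (q * n + b) \<boxplus> ssum S (\<lambda>k. f (Suc (q * n + b) + k)) b"
      by (rule ssum_append) (rule Suc.prems, simp add: n)
    also have "\<dots> = ssum S (\<lambda>K. ssum S (\<lambda>k. f (K * n + k)) b) (Suc q)"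
      using Suc by (simp add: n ac_simps)
    finally show ?case .
  qed simp
  have "ssum S f (q * n + b) = ssum S (\<lambda>K. ssum S (\<lambda>k. f (K * n + k)) b) q"
    using assms(3) unfolding p by (rule split)
  moreover have "p * n - 1 = q * n + b" "n - 1 = b" "p - 1 = q"
    by (simp_all add: p n)
  ultimately show ?thesis
    by simp
qed

text \<open>The next two lemmas replace the rule that zero summands may be dropped: the summands to be
  dropped need only be neutral for the one element \<open>a\<close>.\<close>

lemma ssum_absorb:
  assumes "a \<in> carrier S" and "\<And>k. k \<le> N \<Longrightarrow> f k \<in> carrier S"
    and "\<And>k. k \<le> N \<Longrightarrow> a \<boxplus> f k = a"
  shows "a \<boxplus> ssum S f N = a"
  using assms by (induction N) (auto simp: ssum_closed add_assoc[symmetric])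

lemma ssum_eq_single:
  assumes "i \<le> N" and "f i = a" and "\<And>k. k \<le> N \<Longrightarrow> f k \<in> carrier S"
    and "\<And>k. \<lbrakk>k \<le> N; k \<noteq> i\<rbrakk> \<Longrightarrow> a \<boxplus> f k = a"
  shows "ssum S f N = a"
  using assms
proof (induction N)
  case (Suc N)
  show ?case
  proof (cases "i = Suc N")
    case True
    then have "a \<boxplus> ssum S f N = a"
      using Suc.prems by (intro ssum_absorb) auto
    moreover have "ssum S f N \<in> carrier S" "a \<in> carrier S"
      using Suc.prems by (auto intro: ssum_closed)
    ultimately show ?thesis
      using True Suc.prems(2) by (simp add: add_commute)
  next
    case False
    then show ?thesis
      using Suc by simp
  qed
qed simp

end

section \<open>The semiring of square matrices\<close>

lemma mats_iff:
  "A \<in> mats S m n \<longleftrightarrow> dim_row A = m \<and> dim_col A = n \<and>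
     (\<forall>i < m. \<forall>j < n. A $$ (i, j) \<in> carrier S)"
  unfolding mats_def elements_mat_def by (auto simp: UN_subset_iff image_subset_iff)

lemma mat_add_index:
  "\<lbrakk>A \<in> mats S m n; i < m; j < n\<rbrakk> \<Longrightarrow> mat_add S A B $$ (i, j) = A $$ (i, j) \<boxplus>\<^bsub>S\<^esub> B $$ (i, j)"
  by (simp add: mat_add_def mats_iff)

lemma mat_mul_index:
  "\<lbrakk>A \<in> mats S m p; B \<in> mats S p q; i < m; j < q\<rbrakk> \<Longrightarrow>
    mat_mul S A B $$ (i, j) = ssum S (\<lambda>k. A $$ (i, k) \<boxtimes>\<^bsub>S\<^esub> B $$ (k, j)) (p - 1)"
  by (simp add: mat_mul_def mats_iff)

lemma mats_eqI:
  assumes "A \<in> mats S m n" "B \<in> mats S m n"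
    and "\<And>i j. \<lbrakk>i < m; j < n\<rbrakk> \<Longrightarrow> A $$ (i, j) = B $$ (i, j)"
  shows "A = B"
  using assms by (intro eq_matI) (auto simp: mats_iff)

lemma matrix_semiring_simps [simp]:
  "carrier (matrix_semiring S n) = mats S n n"
  "sadd (matrix_semiring S n) = mat_add S"
  "smul (matrix_semiring S n) = mat_mul S"
  by (simp_all add: matrix_semiring_def)

context local_semiring
begin

lemma mat_add_closed:
  "\<lbrakk>A \<in> mats S m n; B \<in> mats S m n\<rbrakk> \<Longrightarrow> mat_add S A B \<in> mats S m n"
  by (auto simp: mat_add_def mats_iff add_closed)

lemma mat_mul_closed:
  "\<lbrakk>0 < p; A \<in> mats S m p; B \<in> mats S p q\<rbrakk> \<Longrightarrow> mat_mul S A B \<in> mats S m q"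
  by (auto simp: mat_mul_def mats_iff intro!: ssum_closed mul_closed)

lemma mat_mul_assoc:
  assumes p: "0 < p" and q: "0 < q"
    and A: "A \<in> mats S m p" and B: "B \<in> mats S p q" and C: "C \<in> mats S q r"
  shows "mat_mul S (mat_mul S A B) C = mat_mul S A (mat_mul S B C)"
proof (rule mats_eqI)
  show "mat_mul S (mat_mul S A B) C \<in> mats S m r" "mat_mul S A (mat_mul S B C) \<in> mats S m r"
    using assms by (meson mat_mul_closed)+
next
  fix i j assume ij: "i < m" "j < r"
  have a: "A $$ (i, k) \<in> carrier S" if "k \<le> p - 1" for k
    using that A ij p by (auto simp: mats_iff)
  have b: "B $$ (k, l) \<in> carrier S" if "k \<le> p - 1" "l \<le> q - 1" for k l
    using that B p q by (auto simp: mats_iff)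
  have c: "C $$ (l, j) \<in> carrier S" if "l \<le> q - 1" for l
    using that C ij q by (auto simp: mats_iff)
  have "mat_mul S (mat_mul S A B) C $$ (i, j)
      = ssum S (\<lambda>l. ssum S (\<lambda>k. A $$ (i, k) \<boxtimes> B $$ (k, l)) (p - 1) \<boxtimes> C $$ (l, j)) (q - 1)"
    unfolding mat_mul_index[OF mat_mul_closed[OF p A B] C ij]
    using q by (intro ssum_cong) (simp add: mat_mul_index[OF A B ij(1)])
  also have "\<dots> = ssum S (\<lambda>l. ssum S (\<lambda>k. A $$ (i, k) \<boxtimes> B $$ (k, l) \<boxtimes> C $$ (l, j)) (p - 1)) (q - 1)"
    by (intro ssum_cong ssum_mul_right) (auto intro!: mul_closed a b c)
  also have "\<dots> = ssum S (\<lambda>k. ssum S (\<lambda>l. A $$ (i, k) \<boxtimes> B $$ (k, l) \<boxtimes> C $$ (l, j)) (q - 1)) (p - 1)"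
    by (intro ssum_swap) (auto intro!: mul_closed a b c)
  also have "\<dots> = ssum S (\<lambda>k. ssum S (\<lambda>l. A $$ (i, k) \<boxtimes> (B $$ (k, l) \<boxtimes> C $$ (l, j))) (q - 1)) (p - 1)"
    by (intro ssum_cong mul_assoc a b c)
  also have "\<dots> = ssum S (\<lambda>k. A $$ (i, k) \<boxtimes> ssum S (\<lambda>l. B $$ (k, l) \<boxtimes> C $$ (l, j)) (q - 1)) (p - 1)"
    by (intro ssum_cong ssum_mul_left[symmetric]) (auto intro!: mul_closed a b c)
  also have "\<dots> = mat_mul S A (mat_mul S B C) $$ (i, j)"
    unfolding mat_mul_index[OF A mat_mul_closed[OF q B C] ij]
    using p by (intro ssum_cong) (simp add: mat_mul_index[OF B C _ ij(2)])
  finally show "mat_mul S (mat_mul S A B) C $$ (i, j) = mat_mul S A (mat_mul S B C) $$ (i, j)" .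
qed

lemma mat_distrib_left:
  assumes p: "0 < p" and A: "A \<in> mats S m p" and B: "B \<in> mats S p q" and C: "C \<in> mats S p q"
  shows "mat_mul S A (mat_add S B C) = mat_add S (mat_mul S A B) (mat_mul S A C)"
proof (rule mats_eqI)
  show "mat_mul S A (mat_add S B C) \<in> mats S m q"
       "mat_add S (mat_mul S A B) (mat_mul S A C) \<in> mats S m q"
    using assms by (meson mat_mul_closed mat_add_closed)+
next
  fix i j assume ij: "i < m" "j < q"
  have cl: "A $$ (i, k) \<in> carrier S" "B $$ (k, j) \<in> carrier S" "C $$ (k, j) \<in> carrier S"
    if "k \<le> p - 1" for k
    using that A B C ij p by (auto simp: mats_iff)
  have "mat_mul S A (mat_add S B C) $$ (i, j)
      = ssum S (\<lambda>k. A $$ (i, k) \<boxtimes> B $$ (k, j) \<boxplus> A $$ (i, k) \<boxtimes> C $$ (k, j)) (p - 1)"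
    unfolding mat_mul_index[OF A mat_add_closed[OF B C] ij]
    using p by (intro ssum_cong) (simp add: mat_add_index[OF B _ ij(2)] distrib_left cl)
  also have "\<dots> = mat_add S (mat_mul S A B) (mat_mul S A C) $$ (i, j)"
    unfolding mat_add_index[OF mat_mul_closed[OF p A B] ij]
      mat_mul_index[OF A B ij] mat_mul_index[OF A C ij]
    by (intro ssum_add mul_closed cl)
  finally show "mat_mul S A (mat_add S B C) $$ (i, j)
      = mat_add S (mat_mul S A B) (mat_mul S A C) $$ (i, j)" .
qed

lemma mat_distrib_right:
  assumes p: "0 < p" and A: "A \<in> mats S m p" and B: "B \<in> mats S m p" and C: "C \<in> mats S p q"
  shows "mat_mul S (mat_add S A B) C = mat_add S (mat_mul S A C) (mat_mul S B C)"
proof (rule mats_eqI)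
  show "mat_mul S (mat_add S A B) C \<in> mats S m q"
       "mat_add S (mat_mul S A C) (mat_mul S B C) \<in> mats S m q"
    using assms by (meson mat_mul_closed mat_add_closed)+
next
  fix i j assume ij: "i < m" "j < q"
  have cl: "A $$ (i, k) \<in> carrier S" "B $$ (i, k) \<in> carrier S" "C $$ (k, j) \<in> carrier S"
    if "k \<le> p - 1" for k
    using that A B C ij p by (auto simp: mats_iff)
  have "mat_mul S (mat_add S A B) C $$ (i, j)
      = ssum S (\<lambda>k. A $$ (i, k) \<boxtimes> C $$ (k, j) \<boxplus> B $$ (i, k) \<boxtimes> C $$ (k, j)) (p - 1)"
    unfolding mat_mul_index[OF mat_add_closed[OF A B] C ij]
    using p by (intro ssum_cong) (simp add: mat_add_index[OF A ij(1)] distrib_right cl)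
  also have "\<dots> = mat_add S (mat_mul S A C) (mat_mul S B C) $$ (i, j)"
    unfolding mat_add_index[OF mat_mul_closed[OF p A C] ij]
      mat_mul_index[OF A C ij] mat_mul_index[OF B C ij]
    by (intro ssum_add mul_closed cl)
  finally show "mat_mul S (mat_add S A B) C $$ (i, j)
      = mat_add S (mat_mul S A C) (mat_mul S B C) $$ (i, j)" .
qed

lemma mat_local_identities:
  assumes n: "0 < n" and L: "finite L" "L \<noteq> {}" "L \<subseteq> mats S n n"
  shows "\<exists>Z \<in> mats S n n. \<exists>E \<in> mats S n n. \<forall>A \<in> L. \<forall>B \<in> L.
           mat_add S A (mat_mul S Z B) = A \<and> mat_mul S E A = A \<and>
           mat_add S A (mat_mul S B Z) = A \<and> mat_mul S A E = A"
proof -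
  define L' where "L' = (\<Union>A \<in> L. (\<lambda>(i, j). A $$ (i, j)) ` ({..<n} \<times> {..<n}))"
  have "finite L'" "L' \<noteq> {}" "L' \<subseteq> carrier S"
    using L n by (auto simp: L'_def mats_iff subset_iff)
  from local_identities[OF this] obtain z e
    where z: "z \<in> carrier S" and e: "e \<in> carrier S"
      and id: "\<And>a b. \<lbrakk>a \<in> L'; b \<in> L'\<rbrakk> \<Longrightarrow> a \<boxplus> z \<boxtimes> b = a \<and> e \<boxtimes> a = a \<and> a \<boxplus> b \<boxtimes> z = a \<and> a \<boxtimes> e = a"
    by blast
  have one: "e \<boxtimes> a = a" "a \<boxtimes> e = a" if "a \<in> L'" for a
    using id that by blast+
  define Z where "Z = mat n n (\<lambda>(i, j). z)"
  define E where "E = mat n n (\<lambda>(i, j). if i = j then e else z)"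
  have Z: "Z \<in> mats S n n" and E: "E \<in> mats S n n"
    by (auto simp: Z_def E_def mats_iff z e)
  have mem: "A $$ (i, j) \<in> L'" if "A \<in> L" "i < n" "j < n" for A i j
    using that by (force simp: L'_def)
  have "mat_add S A (mat_mul S Z B) = A \<and> mat_mul S E A = A \<and>
        mat_add S A (mat_mul S B Z) = A \<and> mat_mul S A E = A"
    if AB: "A \<in> L" "B \<in> L" for A B
  proof -
    have A: "A \<in> mats S n n" and B: "B \<in> mats S n n"
      using AB L by auto
    have clA: "A $$ (i, j) \<in> carrier S" and clB: "B $$ (i, j) \<in> carrier S"
      if "i < n" "j < n" for i j
      using that A B by (auto simp: mats_iff)
    have "mat_add S A (mat_mul S Z B) = A"
    proof (rule mats_eqI)
      fix i j assume ij: "i < n" "j < n"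
      show "mat_add S A (mat_mul S Z B) $$ (i, j) = A $$ (i, j)"
        unfolding mat_add_index[OF A ij] mat_mul_index[OF Z B ij]
        using n ij AB by (intro ssum_absorb) (auto simp: Z_def z id mem clA clB mul_closed)
    qed (use n A B Z in \<open>auto intro: mat_add_closed mat_mul_closed\<close>)
    moreover have "mat_add S A (mat_mul S B Z) = A"
    proof (rule mats_eqI)
      fix i j assume ij: "i < n" "j < n"
      show "mat_add S A (mat_mul S B Z) $$ (i, j) = A $$ (i, j)"
        unfolding mat_add_index[OF A ij] mat_mul_index[OF B Z ij]
        using n ij AB by (intro ssum_absorb) (auto simp: Z_def z id mem clA clB mul_closed)
    qed (use n A B Z in \<open>auto intro: mat_add_closed mat_mul_closed\<close>)
    moreover have "mat_mul S E A = A"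
    proof (rule mats_eqI)
      fix i j assume ij: "i < n" "j < n"
      show "mat_mul S E A $$ (i, j) = A $$ (i, j)"
        unfolding mat_mul_index[OF E A ij]
        using n ij AB
        by (intro ssum_eq_single[where i = i]) (auto simp: E_def z e id one mem clA mul_closed)
    qed (use n A E in \<open>auto intro: mat_mul_closed\<close>)
    moreover have "mat_mul S A E = A"
    proof (rule mats_eqI)
      fix i j assume ij: "i < n" "j < n"
      show "mat_mul S A E $$ (i, j) = A $$ (i, j)"
        unfolding mat_mul_index[OF A E ij]
        using n ij AB
        by (intro ssum_eq_single[where i = j]) (auto simp: E_def z e id one mem clA mul_closed)
    qed (use n A E in \<open>auto intro: mat_mul_closed\<close>)
    ultimately show ?thesis
      by blast
  qed
  then show ?thesis
    using Z E by blast
qed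

theorem local_semiring_matrix_semiring:
  assumes n: "0 < n"
  shows "local_semiring (matrix_semiring S n)"
proof (unfold_locales, unfold matrix_semiring_simps)
  fix A B C assume A: "A \<in> mats S n n" and B: "B \<in> mats S n n"
  show "mat_add S A B \<in> mats S n n"
    using A B by (rule mat_add_closed)
  show "mat_mul S A B \<in> mats S n n"
    using n A B by (rule mat_mul_closed)
  show "mat_add S A B = mat_add S B A"
    using A B by (intro eq_matI) (auto simp: mat_add_def mats_iff add_commute)
  assume C: "C \<in> mats S n n"
  show "mat_add S (mat_add S A B) C = mat_add S A (mat_add S B C)"
    using A B C by (intro eq_matI) (auto simp: mat_add_def mats_iff add_assoc)
  show "mat_mul S (mat_mul S A B) C = mat_mul S A (mat_mul S B C)"
    using n n A B C by (rule mat_mul_assoc)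
  show "mat_mul S A (mat_add S B C) = mat_add S (mat_mul S A B) (mat_mul S A C)"
    using n A B C by (rule mat_distrib_left)
  show "mat_mul S (mat_add S A B) C = mat_add S (mat_mul S A C) (mat_mul S B C)"
    using n A B C by (rule mat_distrib_right)
qed (rule mat_local_identities[OF n])

end

section \<open>Block matrices\<close>

lemma block_index_less: "K * n + k < p * n" if "K < p" "k < n" for K k n p :: nat
proof -
  have "K * n + k < Suc K * n"
    using that(2) by simp
  also have "\<dots> \<le> p * n"
    using that(1) by (intro mult_le_mono1) simp
  finally show ?thesis .
qed

text \<open>\<open>flatten n X\<close> is the matrix of scalars obtained from a matrix \<open>X\<close> of \<open>n \<times> n\<close> blocks. The
  entry \<open>(i, j)\<close> of block \<open>(I, J)\<close> goes to position \<open>(I * n + i, J * n + j)\<close>.\<close>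

definition flatten :: "nat \<Rightarrow> 'a mat mat \<Rightarrow> 'a mat" where
  "flatten n X = mat (dim_row X * n) (dim_col X * n)
     (\<lambda>(i, j). X $$ (i div n, j div n) $$ (i mod n, j mod n))"

text \<open>\<open>unflatten n m p M\<close> divides an \<open>m * n \<times> p * n\<close> matrix \<open>M\<close> into \<open>n \<times> n\<close> blocks.\<close>

definition unflatten :: "nat \<Rightarrow> nat \<Rightarrow> nat \<Rightarrow> 'a mat \<Rightarrow> 'a mat mat" where
  "unflatten n m p M = mat m p (\<lambda>(I, J). mat n n (\<lambda>(i, j). M $$ (I * n + i, J * n + j)))"

lemma flatten_mats:
  assumes "0 < n" and "X \<in> mats (matrix_semiring S n) m p"
  shows "flatten n X \<in> mats S (m * n) (p * n)"
  using assms by (auto simp: flatten_def mats_iff less_mult_imp_div_less)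

lemma unflatten_mats:
  assumes "M \<in> mats S (m * n) (p * n)"
  shows "unflatten n m p M \<in> mats (matrix_semiring S n) m p"
  using assms by (auto simp: unflatten_def mats_iff block_index_less)

lemma flatten_unflatten:
  assumes "0 < n" and "M \<in> mats S (m * n) (p * n)"
  shows "flatten n (unflatten n m p M) = M"
  using assms
  by (intro eq_matI) (auto simp: flatten_def unflatten_def mats_iff less_mult_imp_div_less)

lemma flatten_index:
  assumes "X \<in> mats (matrix_semiring S n) m p" "I < m" "J < p" "i < n" "j < n"
  shows "flatten n X $$ (I * n + i, J * n + j) = X $$ (I, J) $$ (i, j)"
  using assms by (simp add: flatten_def mats_iff block_index_less)

lemma flatten_inject:
  assumes X: "X \<in> mats (matrix_semiring S n) m p" and Y: "Y \<in> mats (matrix_semiring S n) m p"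
    and eq: "flatten n X = flatten n Y"
  shows "X = Y"
proof (rule mats_eqI[OF X Y])
  fix I J assume IJ: "I < m" "J < p"
  then have "X $$ (I, J) \<in> mats S n n" "Y $$ (I, J) \<in> mats S n n"
    using X Y by (auto simp: mats_iff[of _ "matrix_semiring S n"])
  then show "X $$ (I, J) = Y $$ (I, J)"
    by (rule mats_eqI) (metis X Y IJ eq flatten_index)
qed

context local_semiring
begin

lemma ssum_matrix_semiring:
  assumes "\<And>K. K \<le> N \<Longrightarrow> F K \<in> mats S n n"
  shows "ssum (matrix_semiring S n) F N \<in> mats S n n \<and>
    (\<forall>i < n. \<forall>j < n. ssum (matrix_semiring S n) F N $$ (i, j) = ssum S (\<lambda>K. F K $$ (i, j)) N)"
  using assms by (induction N) (auto simp: mat_add_index[of _ S n n] mat_add_closed)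

lemma flatten_mat_mul:
  assumes n: "0 < n" and p: "0 < p"
    and X: "X \<in> mats (matrix_semiring S n) m p" and Y: "Y \<in> mats (matrix_semiring S n) p q"
  shows "flatten n (mat_mul (matrix_semiring S n) X Y) = mat_mul S (flatten n X) (flatten n Y)"
proof -
  let ?M = "matrix_semiring S n"
  interpret M: local_semiring ?M
    by (rule local_semiring_matrix_semiring[OF n])
  note fX = flatten_mats[OF n X] and fY = flatten_mats[OF n Y]
  have XY: "mat_mul ?M X Y \<in> mats ?M m q"
    by (rule M.mat_mul_closed[OF p X Y])
  show ?thesis
  proof (rule mats_eqI)
    show "flatten n (mat_mul ?M X Y) \<in> mats S (m * n) (q * n)"
      by (rule flatten_mats[OF n XY])
    show "mat_mul S (flatten n X) (flatten n Y) \<in> mats S (m * n) (q * n)"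
      using n p by (intro mat_mul_closed[OF _ fX fY]) simp
  next
    fix r c assume rc: "r < m * n" "c < q * n"
    define I i J j where "I = r div n" and "i = r mod n" and "J = c div n" and "j = c mod n"
    have r: "r = I * n + i" and c: "c = J * n + j"
      by (simp_all add: I_def i_def J_def j_def)
    have IJ: "I < m" "J < q" and ij: "i < n" "j < n"
      using rc n by (simp_all add: I_def i_def J_def j_def less_mult_imp_div_less)
    have blk: "X $$ (I, K) \<in> mats S n n" "Y $$ (K, J) \<in> mats S n n" if "K \<le> p - 1" for K
      using that X Y IJ p by (auto simp: mats_iff[of _ ?M])
    have "flatten n (mat_mul ?M X Y) $$ (r, c) = mat_mul ?M X Y $$ (I, J) $$ (i, j)"
      unfolding r c by (rule flatten_index[OF XY IJ ij])
    also have "\<dots> = ssum S (\<lambda>K. mat_mul S (X $$ (I, K)) (Y $$ (K, J)) $$ (i, j)) (p - 1)"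
      unfolding mat_mul_index[OF X Y IJ] matrix_semiring_simps
      using ij by (intro ssum_matrix_semiring[THEN conjunct2, rule_format] mat_mul_closed[OF n] blk)
    also have "\<dots> = ssum S (\<lambda>K. ssum S (\<lambda>k. flatten n X $$ (r, K * n + k) \<boxtimes>
                      flatten n Y $$ (K * n + k, c)) (n - 1)) (p - 1)"
    proof (intro ssum_cong)
      fix K assume K: "K \<le> p - 1"
      then have Kp: "K < p"
        using p by simp
      show "mat_mul S (X $$ (I, K)) (Y $$ (K, J)) $$ (i, j) =
        ssum S (\<lambda>k. flatten n X $$ (r, K * n + k) \<boxtimes> flatten n Y $$ (K * n + k, c)) (n - 1)"
        unfolding mat_mul_index[OF blk[OF K] ij] r c
        using n by (intro ssum_cong)
          (simp add: flatten_index[OF X IJ(1) Kp ij(1)] flatten_index[OF Y Kp IJ(2) _ ij(2)])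
    qed
    also have "\<dots> = ssum S (\<lambda>k. flatten n X $$ (r, k) \<boxtimes> flatten n Y $$ (k, c)) (p * n - 1)"
      using fX fY rc by (intro ssum_blocks[OF n p, symmetric] mul_closed) (auto simp: mats_iff)
    also have "\<dots> = mat_mul S (flatten n X) (flatten n Y) $$ (r, c)"
      by (rule mat_mul_index[OF fX fY rc, symmetric])
    finally show "flatten n (mat_mul ?M X Y) $$ (r, c)
        = mat_mul S (flatten n X) (flatten n Y) $$ (r, c)" .
  qed
qed

end

section \<open>Separating scalar matrices with several rows or columns\<close>

context exact_semiring
begin

text \<open>(E1) and (E2) with the row \<open>x\<close> and the column \<open>y\<close> replaced by matrices of any number \<open>l\<close> of
  rows or columns, and the separating vectors replaced by matrices of any positive number \<open>q\<close> of
  columns or rows.\<close>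

lemma E1_matrix:
  assumes m: "0 < m" and p: "0 < p" and q: "0 < q" and A: "A \<in> mats S m p" and X: "X \<in> mats S l p"
    and notin: "\<And>U. U \<in> mats S l m \<Longrightarrow> mat_mul S U A \<noteq> X"
  shows "\<exists>V \<in> mats S p q. \<exists>V' \<in> mats S p q.
           mat_mul S A V = mat_mul S A V' \<and> mat_mul S X V \<noteq> mat_mul S X V'"
proof -
  define rw where "rw i = mat 1 p (\<lambda>(_, j). X $$ (i, j))" for i
  have rw: "rw i \<in> mats S 1 p" if "i < l" for i
    using X that by (auto simp: rw_def mats_iff)
  have "\<exists>i < l. rw i \<notin> Row S A"
  proof (rule ccontr)
    assume "\<not> ?thesis"
    moreover have "dim_row A = m"
      using A by (simp add: mats_iff)
    ultimately have "\<forall>i < l. \<exists>u. u \<in> mats S 1 m \<and> mat_mul S u A = rw i"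
      by (fastforce simp: Row_def)
    then obtain u where u: "\<And>i. i < l \<Longrightarrow> u i \<in> mats S 1 m"
        and uA: "\<And>i. i < l \<Longrightarrow> mat_mul S (u i) A = rw i"
      by metis
    define U where "U = mat l m (\<lambda>(i, k). u i $$ (0, k))"
    have U: "U \<in> mats S l m"
      using u by (auto simp: U_def mats_iff)
    have "mat_mul S U A = X"
    proof (rule mats_eqI[OF mat_mul_closed[OF m U A] X])
      fix i j assume ij: "i < l" "j < p"
      have "mat_mul S U A $$ (i, j) = mat_mul S (u i) A $$ (0, j)"
        unfolding mat_mul_index[OF U A ij] mat_mul_index[OF u[OF ij(1)] A less_numeral_extra(1) ij(2)]
        using m ij by (intro ssum_cong) (simp add: U_def)
      also have "\<dots> = X $$ (i, j)"
        using ij by (simp add: uA rw_def)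
      finally show "mat_mul S U A $$ (i, j) = X $$ (i, j)" .
    qed
    with notin[OF U] show False
      by simp
  qed
  then obtain i where i: "i < l" and "rw i \<notin> Row S A"
    by blast
  then obtain v v' where v: "v \<in> mats S p 1" and v': "v' \<in> mats S p 1"
      and eq: "mat_mul S A v = mat_mul S A v'" and neq: "mat_mul S (rw i) v \<noteq> mat_mul S (rw i) v'"
    using E1[OF m p A] rw by blast
  \<comment> \<open>\<open>rep w\<close> consists of \<open>q\<close> copies of the column \<open>w\<close>.\<close>
  define rep where "rep w = mat p q (\<lambda>(k, _). w $$ (k, 0))" for w :: "'a mat"
  have rep: "rep w \<in> mats S p q" if "w \<in> mats S p 1" for w
    using that by (auto simp: rep_def mats_iff)
  have mul_rep: "mat_mul S B (rep w) $$ (r, c) = mat_mul S B w $$ (r, 0)"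
    if "B \<in> mats S k p" "w \<in> mats S p 1" "r < k" "c < q" for B w k r c
    unfolding mat_mul_index[OF that(1) rep[OF that(2)] that(3,4)]
      mat_mul_index[OF that(1,2,3) less_numeral_extra(1)]
    using p that by (intro ssum_cong) (simp add: rep_def)
  have "mat_mul S A (rep v) = mat_mul S A (rep v')"
    by (rule mats_eqI[OF mat_mul_closed[OF p A rep[OF v]] mat_mul_closed[OF p A rep[OF v']]])
      (simp add: mul_rep[OF A v] mul_rep[OF A v'] eq)
  moreover have "mat_mul S X (rep v) \<noteq> mat_mul S X (rep v')"
  proof
    assume "mat_mul S X (rep v) = mat_mul S X (rep v')"
    then have Xv: "mat_mul S X v $$ (i, 0) = mat_mul S X v' $$ (i, 0)"
      using mul_rep[OF X v i q] mul_rep[OF X v' i q] by simp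
    have row: "mat_mul S (rw i) w $$ (0, 0) = mat_mul S X w $$ (i, 0)" if w: "w \<in> mats S p 1" for w
      unfolding mat_mul_index[OF rw[OF i] w less_numeral_extra(1) less_numeral_extra(1)]
        mat_mul_index[OF X w i less_numeral_extra(1)]
      using p by (intro ssum_cong) (simp add: rw_def)
    have "mat_mul S (rw i) v = mat_mul S (rw i) v'"
      by (rule mats_eqI[OF mat_mul_closed[OF p rw[OF i] v] mat_mul_closed[OF p rw[OF i] v']])
        (simp add: row[OF v] row[OF v'] Xv)
    with neq show False
      by simp
  qed
  ultimately show ?thesis
    using rep[OF v] rep[OF v'] by blast
qed

lemma E2_matrix:
  assumes m: "0 < m" and p: "0 < p" and q: "0 < q" and A: "A \<in> mats S m p" and Y: "Y \<in> mats S m l"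
    and notin: "\<And>V. V \<in> mats S p l \<Longrightarrow> mat_mul S A V \<noteq> Y"
  shows "\<exists>U \<in> mats S q m. \<exists>U' \<in> mats S q m.
           mat_mul S U A = mat_mul S U' A \<and> mat_mul S U Y \<noteq> mat_mul S U' Y"
proof -
  define cl where "cl j = mat m 1 (\<lambda>(i, _). Y $$ (i, j))" for j
  have cl: "cl j \<in> mats S m 1" if "j < l" for j
    using Y that by (auto simp: cl_def mats_iff)
  have "\<exists>j < l. cl j \<notin> Col S A"
  proof (rule ccontr)
    assume "\<not> ?thesis"
    moreover have "dim_col A = p"
      using A by (simp add: mats_iff)
    ultimately have "\<forall>j < l. \<exists>v. v \<in> mats S p 1 \<and> mat_mul S A v = cl j"
      by (fastforce simp: Col_def)
    then obtain v where v: "\<And>j. j < l \<Longrightarrow> v j \<in> mats S p 1"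
        and Av: "\<And>j. j < l \<Longrightarrow> mat_mul S A (v j) = cl j"
      by metis
    define V where "V = mat p l (\<lambda>(k, j). v j $$ (k, 0))"
    have V: "V \<in> mats S p l"
      using v by (auto simp: V_def mats_iff)
    have "mat_mul S A V = Y"
    proof (rule mats_eqI[OF mat_mul_closed[OF p A V] Y])
      fix i j assume ij: "i < m" "j < l"
      have "mat_mul S A V $$ (i, j) = mat_mul S A (v j) $$ (i, 0)"
        unfolding mat_mul_index[OF A V ij] mat_mul_index[OF A v[OF ij(2)] ij(1) less_numeral_extra(1)]
        using p ij by (intro ssum_cong) (simp add: V_def)
      also have "\<dots> = Y $$ (i, j)"
        using ij by (simp add: Av cl_def)
      finally show "mat_mul S A V $$ (i, j) = Y $$ (i, j)" .
    qed
    with notin[OF V] show False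
      by simp
  qed
  then obtain j where j: "j < l" and "cl j \<notin> Col S A"
    by blast
  then obtain u u' where u: "u \<in> mats S 1 m" and u': "u' \<in> mats S 1 m"
      and eq: "mat_mul S u A = mat_mul S u' A" and neq: "mat_mul S u (cl j) \<noteq> mat_mul S u' (cl j)"
    using E2[OF m p A] cl by blast
  \<comment> \<open>\<open>rep w\<close> consists of \<open>q\<close> copies of the row \<open>w\<close>.\<close>
  define rep where "rep w = mat q m (\<lambda>(_, k). w $$ (0, k))" for w :: "'a mat"
  have rep: "rep w \<in> mats S q m" if "w \<in> mats S 1 m" for w
    using that by (auto simp: rep_def mats_iff)
  have mul_rep: "mat_mul S (rep w) B $$ (r, c) = mat_mul S w B $$ (0, c)"
    if "B \<in> mats S m k" "w \<in> mats S 1 m" "r < q" "c < k" for B w k r c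
    unfolding mat_mul_index[OF rep[OF that(2)] that(1,3,4)]
      mat_mul_index[OF that(2,1) less_numeral_extra(1) that(4)]
    using m that by (intro ssum_cong) (simp add: rep_def)
  have "mat_mul S (rep u) A = mat_mul S (rep u') A"
    by (rule mats_eqI[OF mat_mul_closed[OF m rep[OF u] A] mat_mul_closed[OF m rep[OF u'] A]])
      (simp add: mul_rep[OF A u] mul_rep[OF A u'] eq)
  moreover have "mat_mul S (rep u) Y \<noteq> mat_mul S (rep u') Y"
  proof
    assume "mat_mul S (rep u) Y = mat_mul S (rep u') Y"
    then have uY: "mat_mul S u Y $$ (0, j) = mat_mul S u' Y $$ (0, j)"
      using mul_rep[OF Y u q j] mul_rep[OF Y u' q j] by simp
    have col: "mat_mul S w (cl j) $$ (0, 0) = mat_mul S w Y $$ (0, j)" if w: "w \<in> mats S 1 m" for w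
      unfolding mat_mul_index[OF w cl[OF j] less_numeral_extra(1) less_numeral_extra(1)]
        mat_mul_index[OF w Y less_numeral_extra(1) j]
      using m by (intro ssum_cong) (simp add: cl_def)
    have "mat_mul S u (cl j) = mat_mul S u' (cl j)"
      by (rule mats_eqI[OF mat_mul_closed[OF m u cl[OF j]] mat_mul_closed[OF m u' cl[OF j]]])
        (simp add: col[OF u] col[OF u'] uY)
    with neq show False
      by simp
  qed
  ultimately show ?thesis
    using rep[OF u] rep[OF u'] by blast
qed

end

section \<open>Exactness of matrix semirings\<close>

theorem corollary5p2:
  fixes S :: "('a, 'm) srng_scheme" and n :: nat
  assumes "exact_semiring S" and "0 < n"
  shows "exact_semiring (matrix_semiring S n)"
proof -
  interpret exact_semiring S
    by fact
  note n = \<open>0 < n\<close>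
  let ?M = "matrix_semiring S n"
  interpret M: local_semiring ?M
    by (rule local_semiring_matrix_semiring[OF n])
  show ?thesis
  proof
    fix m p :: nat and A x
    assume m: "0 < m" and p: "0 < p" and A: "A \<in> mats ?M m p" and x: "x \<in> mats ?M 1 p - Row ?M A"
    note fA = flatten_mats[OF n A]
    have x1: "x \<in> mats ?M 1 p"
      using x by simp
    have "mat_mul S U (flatten n A) \<noteq> flatten n x" if U: "U \<in> mats S (1 * n) (m * n)" for U
    proof
      assume eq: "mat_mul S U (flatten n A) = flatten n x"
      let ?u = "unflatten n 1 m U"
      note u = unflatten_mats[OF U]
      have "flatten n (mat_mul ?M ?u A) = flatten n x"
        by (simp only: flatten_mat_mul[OF n m u A] flatten_unflatten[OF n U] eq)
      then have "x = mat_mul ?M ?u A"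
        using flatten_inject[OF M.mat_mul_closed[OF m u A] x1] by simp
      then show False
        using x u A by (auto simp: Row_def mats_iff[of A])
    qed
    then obtain V V' where V: "V \<in> mats S (p * n) (1 * n)" and V': "V' \<in> mats S (p * n) (1 * n)"
        and eq: "mat_mul S (flatten n A) V = mat_mul S (flatten n A) V'"
        and neq: "mat_mul S (flatten n x) V \<noteq> mat_mul S (flatten n x) V'"
      using E1_matrix[of "m * n" "p * n" "1 * n", OF _ _ _ fA flatten_mats[OF n x1]] m p n
      by (metis mult_1 nat_0_less_mult_iff)
    let ?v = "unflatten n p 1 V" and ?v' = "unflatten n p 1 V'"
    note v = unflatten_mats[OF V] and v' = unflatten_mats[OF V']
    have "flatten n (mat_mul ?M A ?v) = flatten n (mat_mul ?M A ?v')"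
      by (simp only: flatten_mat_mul[OF n p A v] flatten_mat_mul[OF n p A v']
          flatten_unflatten[OF n V] flatten_unflatten[OF n V'] eq)
    then have "mat_mul ?M A ?v = mat_mul ?M A ?v'"
      by (rule flatten_inject[OF M.mat_mul_closed[OF p A v] M.mat_mul_closed[OF p A v']])
    moreover have "mat_mul ?M x ?v \<noteq> mat_mul ?M x ?v'"
      using neq flatten_mat_mul[OF n p x1 v] flatten_mat_mul[OF n p x1 v']
      by (metis flatten_unflatten[OF n V] flatten_unflatten[OF n V'])
    ultimately show "\<exists>v \<in> mats ?M p 1. \<exists>v' \<in> mats ?M p 1.
        mat_mul ?M A v = mat_mul ?M A v' \<and> mat_mul ?M x v \<noteq> mat_mul ?M x v'"
      using v v' by blast
  next
    fix m p :: nat and A y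
    assume m: "0 < m" and p: "0 < p" and A: "A \<in> mats ?M m p" and y: "y \<in> mats ?M m 1 - Col ?M A"
    note fA = flatten_mats[OF n A]
    have y1: "y \<in> mats ?M m 1"
      using y by simp
    have "mat_mul S (flatten n A) V \<noteq> flatten n y" if V: "V \<in> mats S (p * n) (1 * n)" for V
    proof
      assume eq: "mat_mul S (flatten n A) V = flatten n y"
      let ?v = "unflatten n p 1 V"
      note v = unflatten_mats[OF V]
      have "flatten n (mat_mul ?M A ?v) = flatten n y"
        by (simp only: flatten_mat_mul[OF n p A v] flatten_unflatten[OF n V] eq)
      then have "y = mat_mul ?M A ?v"
        using flatten_inject[OF M.mat_mul_closed[OF p A v] y1] by simp
      then show False
        using y v A by (auto simp: Col_def mats_iff[of A])
    qed
    then obtain U U' where U: "U \<in> mats S (1 * n) (m * n)" and U': "U' \<in> mats S (1 * n) (m * n)"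
        and eq: "mat_mul S U (flatten n A) = mat_mul S U' (flatten n A)"
        and neq: "mat_mul S U (flatten n y) \<noteq> mat_mul S U' (flatten n y)"
      using E2_matrix[of "m * n" "p * n" "1 * n", OF _ _ _ fA flatten_mats[OF n y1]] m p n
      by (metis mult_1 nat_0_less_mult_iff)
    let ?u = "unflatten n 1 m U" and ?u' = "unflatten n 1 m U'"
    note u = unflatten_mats[OF U] and u' = unflatten_mats[OF U']
    have "flatten n (mat_mul ?M ?u A) = flatten n (mat_mul ?M ?u' A)"
      by (simp only: flatten_mat_mul[OF n m u A] flatten_mat_mul[OF n m u' A]
          flatten_unflatten[OF n U] flatten_unflatten[OF n U'] eq)
    then have "mat_mul ?M ?u A = mat_mul ?M ?u' A"
      by (rule flatten_inject[OF M.mat_mul_closed[OF m u A] M.mat_mul_closed[OF m u' A]])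
    moreover have "mat_mul ?M ?u y \<noteq> mat_mul ?M ?u' y"
      using neq flatten_mat_mul[OF n m u y1] flatten_mat_mul[OF n m u' y1]
      by (metis flatten_unflatten[OF n U] flatten_unflatten[OF n U'])
    ultimately show "\<exists>u \<in> mats ?M 1 m. \<exists>u' \<in> mats ?M 1 m.
        mat_mul ?M u A = mat_mul ?M u' A \<and> mat_mul ?M u y \<noteq> mat_mul ?M u' y"
      using u u' by blast
  qed
qed

end
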